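(* Let $p$ be an odd prime, $d\geq 2$ a divisor of $p-1$, $m=(p-1)/d$, and $1\le k\le d$. For each divisor $e$ of $\gcd(d,k)$ let $\mathcal{T}_e(d,k)$ be any transversal (a set containing exactly one element of each orbit) of the $\mathbb{Z}/d\mathbb{Z}$-orbits in $M_e(d,k)$. Then the $k$-th Viète coefficient of the degree-$d$ Gauss period polynomial is \[ a_k(p,d)=\sum_{e\mid \gcd(d,k)}\frac{1}{e}\Big[p\Big(\sum_{S\in\mathcal{T}_e(d,k)} z(S)\Big)-\#\mathcal{T}_e(d,k)\cdot m^{k-1}\Big]. \]
   Context: Fix a primitive root $g$ modulo $p$. For $s\in\mathbb{Z}$ (taken mod $d$) let $C_s=\{g^{jd+s}: j=0,\dots,m-1\}\subset\mathbb{F}_p^*$, so $\mathbf{F}_p^*=C_0\sqcup\cdots\sqcup C_{d-1}$. Let $\zeta$ be a primitive complex $p$-th root of unity and $\eta_j=\sum_{x\in C_j}\zeta^x$ ($j=0,\dots,d-1$), the Gauss $d$-periods. Define $a_k(p,d)$ by $\prod_{j=0}^{d-1}(X-\eta_j)=X^d+\sum_{k=1}^d(-1)^k a_k(p,d)X^{d-k}$, i.e. $a_k(p,d)$ is the $k$-th elementary symmetric function of $\eta_0,\dots,\eta_{d-1}$. Gauss symbol: for nonempty $M_1,\dots,M_n\subseteq\mathbf{F}_p$, $\{M_1,\dots,M_n\}=\#\{(x_1,\dots,x_n)\in M_1\times\cdots\times M_n: x_1+\cdots+x_n=0\}$. For a $k$-subset $S=\{s_1<\dots<s_k\}$ of $\{0,1,\dots,d-1\}$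 put $z(S)=\{\{g^{s_1}\},C_{s_2},\dots,C_{s_k}\}$. Identify $k$-subsets of $\{0,\dots,d-1\}$ with $k$-subsets of $\mathbb{Z}/d\mathbb{Z}$; let $M(d,k)$ be the set of these, with $\mathbb{Z}/d\mathbb{Z}$ acting by translation $\nu\cdot S=\{s+\nu \bmod d: s\in S\}$. For $e\mid\gcd(d,k)$, $M_e(d,k)$ is the set of $S\in M(d,k)$ whose stabilizer in $\mathbb{Z}/d\mathbb{Z}$ has order $e$. *)

theory Defs
  imports
    Complex_Main
    "HOL-Computational_Algebra.Polynomial"
    "HOL-Number_Theory.Residue_Primitive_Roots"
    "HOL-Algebra.Group_Action"
    "HOL-Algebra.Elementary_Groups"
begin

text \<open>
  The field of \<open>p\<close> elements is represented by its least non-negative residues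
  \<open>{0..<p} :: nat set\<close>, and \<open>\<int>/d\<int>\<close> by the library group
  \<open>integer_mod_group d\<close> with carrier \<open>{0..<int d}\<close> (for \<open>d > 0\<close>).
\<close>

definition is_primitive_root_of_unity :: "nat \<Rightarrow> complex \<Rightarrow> bool" where
  "is_primitive_root_of_unity n \<zeta> \<longleftrightarrow> \<zeta> ^ n = 1 \<and> (\<forall>i. 0 < i \<and> i < n \<longrightarrow> \<zeta> ^ i \<noteq> 1)"

definition cyclotomic_class :: "nat \<Rightarrow> nat \<Rightarrow> nat \<Rightarrow> int \<Rightarrow> nat set" where
  "cyclotomic_class p g d s =
     (\<lambda>j. g ^ (j * d + nat (s mod int d)) mod p) ` {..<(p - 1) div d}"

definition gauss_period :: "nat \<Rightarrow> nat \<Rightarrow> nat \<Rightarrow> complex \<Rightarrow> int \<Rightarrow> complex" where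
  "gauss_period p g d \<zeta> j = (\<Sum>x\<in>cyclotomic_class p g d j. \<zeta> ^ x)"

definition gauss_period_poly :: "nat \<Rightarrow> nat \<Rightarrow> nat \<Rightarrow> complex \<Rightarrow> complex poly" where
  "gauss_period_poly p g d \<zeta> = (\<Prod>j\<in>{0..<int d}. [:- gauss_period p g d \<zeta> j, 1:])"

definition viete_coeff :: "nat \<Rightarrow> nat \<Rightarrow> nat \<Rightarrow> complex \<Rightarrow> nat \<Rightarrow> complex" where
  "viete_coeff p g d \<zeta> k = (-1) ^ k * poly.coeff (gauss_period_poly p g d \<zeta>) (d - k)"

lemma gauss_period_poly_eq:
  "gauss_period_poly p g d \<zeta> =
     Polynomial.monom 1 d + (\<Sum>k=1..d. Polynomial.monom ((-1) ^ k * viete_coeff p g d \<zeta> k) (d - k))"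
proof -
  let ?P = "gauss_period_poly p g d \<zeta>"
  have deg: "Polynomial.degree ?P = d"
    unfolding gauss_period_poly_def by (subst degree_prod_eq_sum_degree) auto
  have lead: "poly.coeff ?P d = 1"
  proof -
    have "poly.coeff ?P (Polynomial.degree ?P) = 1"
      unfolding gauss_period_poly_def by (subst lead_coeff_prod) auto
    thus ?thesis by (simp add: deg)
  qed
  have "?P = (\<Sum>i\<le>d. Polynomial.monom (poly.coeff ?P i) i)"
    using poly_as_sum_of_monoms[of ?P] by (simp add: deg)
  also have "\<dots> = (\<Sum>k\<le>d. Polynomial.monom (poly.coeff ?P (d - k)) (d - k))"
    by (rule sum.reindex_bij_witness[of _ "\<lambda>k. d - k" "\<lambda>k. d - k"]) auto
  also have "{..d} = insert 0 {1..d}" by auto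
  also have "(\<Sum>k\<in>insert 0 {1..d}. Polynomial.monom (poly.coeff ?P (d - k)) (d - k)) =
               Polynomial.monom 1 d + (\<Sum>k=1..d. Polynomial.monom (poly.coeff ?P (d - k)) (d - k))"
    by (simp add: lead)
  finally show ?thesis
    by (simp add: viete_coeff_def mult.assoc[symmetric] flip: power_mult_distrib)
qed

definition gauss_symbol :: "nat \<Rightarrow> nat set list \<Rightarrow> nat" where
  "gauss_symbol p Ms = card {xs \<in> listset Ms. [sum_list xs = 0] (mod p)}"

definition z_symbol :: "nat \<Rightarrow> nat \<Rightarrow> nat \<Rightarrow> int set \<Rightarrow> nat" where
  "z_symbol p g d S =
     (let ss = sorted_list_of_set S
      in gauss_symbol p ({g ^ nat (hd ss) mod p} # map (cyclotomic_class p g d) (tl ss)))"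

definition k_subsets :: "nat \<Rightarrow> nat \<Rightarrow> int set set" where
  "k_subsets d k = {S. S \<subseteq> carrier (integer_mod_group d) \<and> card S = k}"

definition translation :: "nat \<Rightarrow> int \<Rightarrow> int set \<Rightarrow> int set" where
  "translation d \<nu> S = (\<lambda>s. s \<otimes>\<^bsub>integer_mod_group d\<^esub> \<nu>) ` S"

definition k_subsets_stab :: "nat \<Rightarrow> nat \<Rightarrow> nat \<Rightarrow> int set set" where
  "k_subsets_stab d k e =
     {S \<in> k_subsets d k. card (stabilizer (integer_mod_group d) (translation d) S) = e}"

definition is_transversal :: "nat \<Rightarrow> nat \<Rightarrow> nat \<Rightarrow> int set set \<Rightarrow> bool" where
  "is_transversal d k e T \<longleftrightarrow>
     T \<subseteq> k_subsets_stab d k e \<and>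
     (\<forall>A \<in> orbits (integer_mod_group d) (k_subsets_stab d k e) (translation d).
        \<exists>!S. S \<in> T \<inter> A)"

end

theory Submission
  imports Defs
begin

text \<open>
  By Viete, \<open>a\<^sub>k\<close> is the sum over all \<open>k\<close>-subsets \<open>S\<close> of \<open>P(S) = \<Prod>s\<in>S. \<eta>\<^sub>s\<close>. Detecting zero sums
  with the additive characters modulo \<open>p\<close> and grouping the nonzero frequencies by their
  cyclotomic class gives \<open>\<Sum>\<nu>. P(S + \<nu>) = p * z(S) - m ^ (k - 1)\<close>. In this sum over the
  translates every element of the orbit of \<open>S\<close> occurs as often as the order \<open>e\<close> of the stabilizer,
  and \<open>e\<close> divides both \<open>d\<close> (Lagrange) and \<open>k\<close> (\<open>S\<close> is a union of cosets of its stabilizer).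
\<close>

section \<open>Translates of a subset of a group\<close>

context group
begin

lemma subgroup_rcos_stabilizer:
  assumes "S \<subseteq> carrier G"
  shows "subgroup {a \<in> carrier G. S #> a = S} G"
proof
  fix a assume a: "a \<in> {a \<in> carrier G. S #> a = S}"
  then have carr: "a \<in> carrier G"
    by simp
  have "S #> inv a = (S #> a) #> inv a"
    using a by simp
  also have "\<dots> = S"
    using carr assms by (simp add: coset_mult_assoc)
  finally show "inv a \<in> {a \<in> carrier G. S #> a = S}"
    using a by simp
qed (use assms in \<open>auto simp flip: coset_mult_assoc\<close>)

text \<open>If \<open>a\<close> and \<open>b\<close> move \<open>S\<close> to the same set, then
  \<open>a \<otimes> inv b\<close> fixes \<open>S\<close>. Hence all nonempty fibers of
  \<open>a \<mapsto> S #> a\<close> have the size of the stabilizer.\<close>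

lemma rcos_fiber_eq_coset:
  assumes S: "S \<subseteq> carrier G" and b: "b \<in> carrier G"
  shows "{a \<in> carrier G. S #> a = S #> b} = {a \<in> carrier G. S #> a = S} #> b" (is "?L = ?H #> b")
proof (intro subset_antisym subsetI)
  fix a assume a: "a \<in> ?L"
  then have carr: "a \<in> carrier G"
    by simp
  have "S #> (a \<otimes> inv b) = (S #> a) #> inv b"
    using carr S b by (simp add: coset_mult_assoc)
  also have "\<dots> = (S #> b) #> inv b"
    using a by simp
  also have "\<dots> = S"
    using S b by (simp add: coset_mult_assoc)
  finally have "a \<otimes> inv b \<in> ?H"
    using a b by simp
  moreover have "a = (a \<otimes> inv b) \<otimes> b"
    using a b by (simp add: m_assoc)
  ultimately show "a \<in> ?H #> b"
    unfolding r_coset_def by blast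
next
  fix a assume "a \<in> ?H #> b"
  then obtain h where "h \<in> ?H" "a = h \<otimes> b"
    unfolding r_coset_def by blast
  then show "a \<in> ?L"
    using S b by (simp flip: coset_mult_assoc)
qed

text \<open>A weighted orbit-stabilizer theorem: the sum is grouped by the value of
  \<open>S #> a\<close>, and each group is a right coset of the stabilizer.\<close>

lemma sum_rcos_eq_sum_orbit:
  fixes f :: "'a set \<Rightarrow> 'c :: semiring_1"
  assumes S: "S \<subseteq> carrier G" and fin: "finite (carrier G)"
  shows "(\<Sum>a\<in>carrier G. f (S #> a)) =
           of_nat (card {a \<in> carrier G. S #> a = S}) * (\<Sum>X\<in>(#>) S ` carrier G. f X)"
proof -
  let ?H = "{a \<in> carrier G. S #> a = S}"
  have "(\<Sum>a\<in>carrier G. f (S #> a)) =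
        (\<Sum>X\<in>(#>) S ` carrier G. \<Sum>a | a \<in> carrier G \<and> S #> a = X. f (S #> a))"
    using fin by (rule sum.image_gen)
  also have "\<dots> = (\<Sum>X\<in>(#>) S ` carrier G. of_nat (card ?H) * f X)"
  proof (rule sum.cong[OF refl])
    fix X assume "X \<in> (#>) S ` carrier G"
    then obtain b where b: "b \<in> carrier G" "X = S #> b"
      by blast
    have "?H #> b \<in> rcosets ?H"
      using b by (intro rcosetsI) auto
    then have "card (?H #> b) = card ?H"
      by (intro card_rcosets_equal[symmetric]) auto
    then have "card {a \<in> carrier G. S #> a = X} = card ?H"
      using rcos_fiber_eq_coset[OF S b(1)] b(2) by simp
    then show "(\<Sum>a | a \<in> carrier G \<and> S #> a = X. f (S #> a)) = of_nat (card ?H) * f X"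
      by simp
  qed
  finally show ?thesis
    by (simp add: sum_distrib_left)
qed

lemma rcos_orbit_eq:
  assumes S: "S \<subseteq> carrier G" and b: "b \<in> carrier G"
  shows "(#>) (S #> b) ` carrier G = (#>) S ` carrier G"
proof (intro subset_antisym subsetI)
  fix X assume "X \<in> (#>) (S #> b) ` carrier G"
  then show "X \<in> (#>) S ` carrier G"
    using S b by (auto simp: coset_mult_assoc)
next
  fix X assume "X \<in> (#>) S ` carrier G"
  then obtain a where a: "a \<in> carrier G" "X = S #> a"
    by blast
  then have "X = (S #> b) #> (inv b \<otimes> a)"
    using S b by (simp add: coset_mult_assoc m_assoc[symmetric])
  then show "X \<in> (#>) (S #> b) ` carrier G"
    using a b by blast
qed

end

text \<open>The stabilizer \<open>?H\<close> acts on \<open>S\<close> from the right, whereas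
  \<open>rcosets\<close> multiply it on the left. Commutativity reconciles the two sides, so
  \<open>S\<close> is a disjoint union of cosets \<open>?H #> s\<close>, all of size
  \<open>card ?H\<close>.\<close>

lemma (in comm_group) card_rcos_stabilizer_dvd:
  assumes S: "S \<subseteq> carrier G" and fin: "finite S"
  shows "card {a \<in> carrier G. S #> a = S} dvd card S"
proof -
  let ?H = "{a \<in> carrier G. S #> a = S}"
  let ?C = "(\<lambda>s. ?H #> s) ` S"
  have H: "subgroup ?H G"
    using S by (rule subgroup_rcos_stabilizer)
  have C: "?C \<subseteq> rcosets ?H"
    using S by (auto intro!: rcosetsI)
  have un: "\<Union>?C = S"
  proof (intro subset_antisym subsetI)
    fix x assume "x \<in> \<Union>?C"
    then obtain s h where sh: "s \<in> S" "h \<in> ?H" "x = h \<otimes> s"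
      unfolding r_coset_def by blast
    then have "x = s \<otimes> h"
      using S by (auto intro: m_comm)
    then have "x \<in> S #> h"
      using sh(1) unfolding r_coset_def by blast
    then show "x \<in> S"
      using sh(2) by simp
  next
    fix x assume x: "x \<in> S"
    then have "x \<in> ?H #> x"
      using S H by (intro rcos_self) auto
    then show "x \<in> \<Union>?C"
      using x by blast
  qed
  have "card ?H * card ?C = card (\<Union>?C)"
  proof (rule card_partition)
    show "card c = card ?H" if "c \<in> ?C" for c
      by (rule card_rcosets_equal[symmetric]) (use C that in blast)+
    show "c1 \<inter> c2 = {}" if "c1 \<in> ?C" "c2 \<in> ?C" "c1 \<noteq> c2" for c1 c2
      using pairwiseD[OF rcos_disjoint[OF H] subsetD[OF C that(1)] subsetD[OF C that(2)] that(3)]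
      by (simp add: disjnt_def)
  qed (simp_all only: un fin finite_imageI)
  then have "card S = card ?H * card ?C"
    by (simp only: un)
  then show ?thesis
    by (rule dvdI)
qed

text \<open>Stabilizers along an orbit are conjugate in general, hence equal in an abelian group.
  The order of the stabilizer is therefore constant on orbits.\<close>

lemma (in comm_group) rcos_stabilizer_rcos:
  assumes S: "S \<subseteq> carrier G" and a: "a \<in> carrier G" and b: "b \<in> carrier G"
  shows "(S #> a) #> b = S #> a \<longleftrightarrow> S #> b = S"
proof -
  have swap: "(S #> a) #> b = (S #> b) #> a"
    using S a b by (simp add: coset_mult_assoc m_comm)
  have cancel: "(X #> a) #> inv a = X" if "X \<subseteq> carrier G" for X
    using that a by (simp add: coset_mult_assoc)
  show ?thesis
    unfolding swap using cancel[OF S] cancel[OF r_coset_subset_G[OF S b]] by metis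
qed

section \<open>Summation over a transversal\<close>

text \<open>The bridge by which the coset lemmas above apply to stabilizers and orbits in
  \<open>integer_mod_group d\<close>.\<close>

lemma translation_eq_rcos: "translation d \<nu> S = S #>\<^bsub>integer_mod_group d\<^esub> \<nu>"
  by (auto simp: translation_def r_coset_def)

lemma stabilizer_translation:
  "stabilizer (integer_mod_group d) (translation d) S =
     {a \<in> carrier (integer_mod_group d). S #>\<^bsub>integer_mod_group d\<^esub> a = S}"
  by (simp add: stabilizer_def translation_eq_rcos)

lemma orbit_translation:
  "orbit (integer_mod_group d) (translation d) S =
     (#>\<^bsub>integer_mod_group d\<^esub>) S ` carrier (integer_mod_group d)"
  by (auto simp: orbit_def translation_eq_rcos)

text \<open>Guarantees that the sets \<open>k_subsets_stab d k e\<close> with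
  \<open>e dvd gcd d k\<close> exhaust all \<open>k\<close>-subsets.\<close>

lemma card_stabilizer_dvd_gcd:
  assumes d: "d > 0" and S: "S \<in> k_subsets d k"
  shows "card (stabilizer (integer_mod_group d) (translation d) S) dvd gcd d k"
proof -
  interpret comm_group "integer_mod_group d" by simp
  have fin: "finite (carrier (integer_mod_group d))" and ord: "order (integer_mod_group d) = d"
    using d by (auto simp: carrier_integer_mod_group order_def)
  have sub: "S \<subseteq> carrier (integer_mod_group d)" and k: "card S = k"
    using S by (auto simp: k_subsets_def)
  have "card (stabilizer (integer_mod_group d) (translation d) S) dvd order (integer_mod_group d)"
    unfolding stabilizer_translation lagrange[OF subgroup_rcos_stabilizer[OF sub], symmetric]
    by (rule dvd_triv_right)
  moreover have "card (stabilizer (integer_mod_group d) (translation d) S) dvd card S"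
    unfolding stabilizer_translation
    using sub finite_subset[OF sub fin] by (rule card_rcos_stabilizer_dvd)
  ultimately show ?thesis
    using ord k by simp
qed

lemma translation_in_k_subsets_stab:
  assumes d: "d > 0" and S: "S \<in> k_subsets_stab d k e"
    and a: "a \<in> carrier (integer_mod_group d)"
  shows "translation d a S \<in> k_subsets_stab d k e"
proof -
  interpret comm_group "integer_mod_group d" by simp
  let ?G = "integer_mod_group d"
  have sub: "S \<subseteq> carrier ?G" and k: "card S = k"
    using S by (auto simp: k_subsets_def k_subsets_stab_def)
  have "card (S #>\<^bsub>?G\<^esub> a) = k"
    using card_rcosets_equal[OF rcosetsI[OF sub a] sub] k by simp
  moreover have "(S #>\<^bsub>?G\<^esub> a) #>\<^bsub>?G\<^esub> b = S #>\<^bsub>?G\<^esub> a \<longleftrightarrow> S #>\<^bsub>?G\<^esub> b = S"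
    if "b \<in> carrier ?G" for b
    using sub a that by (rule rcos_stabilizer_rcos)
  moreover have "S #>\<^bsub>?G\<^esub> a \<subseteq> carrier ?G"
    using sub a by (rule r_coset_subset_G)
  ultimately show ?thesis
    using S unfolding k_subsets_stab_def k_subsets_def stabilizer_translation translation_eq_rcos
    by (simp cong: conj_cong)
qed

text \<open>The orbits of the elements of \<open>T\<close> partition
  \<open>k_subsets_stab d k e\<close>. The sum over all \<open>d\<close> translates of
  \<open>S\<close> meets each member of its orbit \<open>e\<close> times, whence the factor
  \<open>1 / e\<close>.\<close>

lemma sum_transversal:
  fixes f :: "int set \<Rightarrow> complex"
  assumes d: "d > 0" and e: "e > 0" and T: "is_transversal d k e T"
  shows "(\<Sum>S\<in>k_subsets_stab d k e. f S) =
           (\<Sum>S\<in>T. 1 / of_nat e * (\<Sum>\<nu>\<in>{0..<int d}. f (translation d \<nu> S)))"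
proof -
  interpret comm_group "integer_mod_group d" by simp
  let ?G = "integer_mod_group d"
  let ?M = "k_subsets_stab d k e"
  let ?O = "orbit ?G (translation d)"
  have carr: "carrier ?G = {0..<int d}"
    using d by (simp add: carrier_integer_mod_group)
  have sub: "S \<subseteq> carrier ?G" if "S \<in> ?M" for S
    using that by (auto simp: k_subsets_def k_subsets_stab_def)
  have TM: "T \<subseteq> ?M" and ex1: "\<And>A. A \<in> orbits ?G ?M (translation d) \<Longrightarrow> \<exists>!S. S \<in> T \<inter> A"
    using T by (auto simp: is_transversal_def)
  have finM: "finite ?M"
    by (rule finite_subset[of _ "Pow {0..<int d}"]) (use sub carr in auto)
  have finO: "finite (?O S)" for S
    unfolding orbit_translation carr by simp
  have self: "S \<in> ?O S" if "S \<in> ?M" for S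
    unfolding orbit_translation using sub[OF that] coset_mult_one[of S]
    by (metis image_eqI one_closed)
  have Oeq: "?O X = ?O S" if "S \<in> ?M" "X \<in> ?O S" for S X
    using that rcos_orbit_eq[OF sub[OF that(1)]] unfolding orbit_translation by auto
  have OM: "?O S \<subseteq> ?M" if "S \<in> ?M" for S
    using translation_in_k_subsets_stab[OF d that] by (auto simp: orbit_def)
  have cover: "?M = (\<Union>S\<in>T. ?O S)"
  proof (intro subset_antisym subsetI)
    fix X assume X: "X \<in> ?M"
    then obtain S where "S \<in> T" "S \<in> ?O X"
      using ex1[of "?O X"] by (auto simp: orbits_def)
    then show "X \<in> (\<Union>S\<in>T. ?O S)"
      using Oeq[OF X] self[OF X] by blast
  qed (use OM TM in blast)
  \<comment> \<open>Orbits that meet coincide, so \<open>S\<close> and \<open>S'\<close> would be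
    two representatives of one orbit.\<close>
  have disj: "?O S \<inter> ?O S' = {}" if "S \<in> T" "S' \<in> T" "S \<noteq> S'" for S S'
  proof (rule ccontr)
    assume "?O S \<inter> ?O S' \<noteq> {}"
    then obtain X where "X \<in> ?O S" "X \<in> ?O S'"
      by blast
    then have "?O S = ?O S'"
      using Oeq that TM by blast
    then have "S \<in> T \<inter> ?O S" "S' \<in> T \<inter> ?O S"
      using self that TM by blast+
    moreover have "?O S \<in> orbits ?G ?M (translation d)"
      using that TM by (auto simp: orbits_def)
    ultimately show False
      using ex1 that(3) by blast
  qed
  have "(\<Sum>S\<in>?M. f S) = (\<Sum>S\<in>T. \<Sum>X\<in>?O S. f X)"
    unfolding cover using finite_subset[OF TM finM] finO disj
    by (intro sum.UNION_disjoint) auto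
  also have "\<dots> = (\<Sum>S\<in>T. 1 / of_nat e * (\<Sum>\<nu>\<in>{0..<int d}. f (translation d \<nu> S)))"
  proof (rule sum.cong[OF refl])
    fix S assume "S \<in> T"
    then have S: "S \<in> ?M"
      using TM by blast
    have "(\<Sum>\<nu>\<in>carrier ?G. f (S #>\<^bsub>?G\<^esub> \<nu>)) = of_nat e * (\<Sum>X\<in>?O S. f X)"
      using sum_rcos_eq_sum_orbit[OF sub[OF S], of f] S
      by (simp add: carr orbit_translation k_subsets_stab_def stabilizer_translation)
    then show "(\<Sum>X\<in>?O S. f X) = 1 / of_nat e * (\<Sum>\<nu>\<in>{0..<int d}. f (translation d \<nu> S))"
      using e by (simp add: carr translation_eq_rcos)
  qed
  finally show ?thesis .
qed

section \<open>Coefficients of a product of linear factors\<close>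

text \<open>Expanding the product amounts to choosing the set \<open>S\<close> of factors that
  contribute their constant term; the others contribute the variable, giving degree
  \<open>card A - card S\<close>.\<close>

lemma coeff_prod_linear:
  fixes f :: "'a \<Rightarrow> 'b :: comm_ring_1"
  assumes A: "finite A" and k: "k \<le> card A"
  shows "poly.coeff (\<Prod>a\<in>A. [:- f a, 1:]) (card A - k) =
           (-1) ^ k * (\<Sum>S | S \<subseteq> A \<and> card S = k. \<Prod>a\<in>S. f a)"
proof -
  have split: "[:- f a, 1:] = [:- f a:] + Polynomial.monom 1 1" for a
    by (simp add: monom_altdef)
  have const: "(\<Prod>a\<in>S. [:- f a:]) = [:(-1) ^ card S * (\<Prod>a\<in>S. f a):]" for S
    by (induction S rule: infinite_finite_induct) (auto simp: algebra_simps)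
  have "(\<Prod>a\<in>A. [:- f a, 1:]) =
        (\<Sum>S\<in>Pow A. (\<Prod>a\<in>S. [:- f a:]) * (\<Prod>a\<in>A - S. Polynomial.monom 1 1))"
    unfolding split using A by (rule prod_add)
  also have "\<dots> = (\<Sum>S\<in>Pow A. Polynomial.monom ((-1) ^ card S * (\<Prod>a\<in>S. f a)) (card A - card S))"
  proof (rule sum.cong[OF refl])
    fix S assume "S \<in> Pow A"
    then have "card (A - S) = card A - card S"
      using A by (intro card_Diff_subset) (auto intro: finite_subset)
    then show "(\<Prod>a\<in>S. [:- f a:]) * (\<Prod>a\<in>A - S. Polynomial.monom 1 1) =
        Polynomial.monom ((-1) ^ card S * (\<Prod>a\<in>S. f a)) (card A - card S)"
      by (simp add: const monom_power smult_monom)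
  qed
  finally have "poly.coeff (\<Prod>a\<in>A. [:- f a, 1:]) (card A - k) =
      (\<Sum>S\<in>Pow A. if card A - card S = card A - k then (-1) ^ card S * (\<Prod>a\<in>S. f a) else 0)"
    by (simp add: Polynomial.coeff_sum)
  \<comment> \<open>Subtraction on \<open>nat\<close> is truncated; cancelling \<open>card A\<close>
    is sound because \<open>card S\<close> and \<open>k\<close> are both at most
    \<open>card A\<close>.\<close>
  also have "\<dots> = (\<Sum>S\<in>Pow A. if card S = k then (-1) ^ card S * (\<Prod>a\<in>S. f a) else 0)"
  proof (rule sum.cong[OF refl])
    fix S assume "S \<in> Pow A"
    then have "card S \<le> card A"
      using A by (auto intro: card_mono)
    then show "(if card A - card S = card A - k then (-1) ^ card S * (\<Prod>a\<in>S. f a) else 0) =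
               (if card S = k then (-1) ^ card S * (\<Prod>a\<in>S. f a) else 0)"
      using k by auto
  qed
  also have "\<dots> = (\<Sum>S | S \<in> Pow A \<and> card S = k. (-1) ^ card S * (\<Prod>a\<in>S. f a))"
    using A by (subst sum.inter_filter[symmetric]) auto
  also have "\<dots> = (-1) ^ k * (\<Sum>S | S \<subseteq> A \<and> card S = k. \<Prod>a\<in>S. f a)"
    unfolding sum_distrib_left by (rule sum.cong) auto
  finally show ?thesis .
qed

lemma viete_coeff_eq_sum_k_subsets:
  assumes "d > 0" and "k \<le> d"
  shows "viete_coeff p g d \<zeta> k = (\<Sum>S\<in>k_subsets d k. \<Prod>s\<in>S. gauss_period p g d \<zeta> s)"
  using coeff_prod_linear[of "{0..<int d}" k "gauss_period p g d \<zeta>"] assms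
  by (simp add: viete_coeff_def gauss_period_poly_def k_subsets_def carrier_integer_mod_group
        mult.assoc[symmetric] flip: power_mult_distrib)

section \<open>Additive characters and Gauss symbols\<close>

text \<open>In this form finiteness and sums carry over from cartesian products, the map being
  injective.\<close>

lemma listset_Cons_eq_image: "listset (A # As) = (\<lambda>(x, xs). x # xs) ` (A \<times> listset As)"
  by (auto simp: set_Cons_def)

lemma finite_listset:
  assumes "\<And>A. A \<in> set As \<Longrightarrow> finite A"
  shows "finite (listset As)"
  using assms by (induction As) (simp_all add: listset_Cons_eq_image del: listset.simps(2))

text \<open>Powers turn the sum of the entries into a product, so the sum over tuples factors
  coordinatewise.\<close>

lemma sum_listset_power:
  fixes z :: "'a :: comm_semiring_1"
  shows "(\<Sum>xs\<in>listset Ms. z ^ sum_list xs) = (\<Prod>M\<leftarrow>Ms. \<Sum>x\<in>M. z ^ x)"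
proof (induction Ms)
  case (Cons M Ms)
  have "(\<Sum>xs\<in>listset (M # Ms). z ^ sum_list xs) =
        (\<Sum>(x, xs)\<in>M \<times> listset Ms. z ^ (x + sum_list xs))"
    unfolding listset_Cons_eq_image
    by (subst sum.reindex) (auto simp: inj_on_def case_prod_unfold)
  also have "\<dots> = (\<Sum>x\<in>M. z ^ x) * (\<Sum>xs\<in>listset Ms. z ^ sum_list xs)"
    by (simp add: sum_product sum.cartesian_product power_add)
  finally show ?case
    using Cons.IH by simp
qed auto

section \<open>Orthogonality of the additive characters modulo \<open>p\<close>\<close>

locale root_of_unity =
  fixes p :: nat and \<zeta> :: complex
  assumes p_pos: "p > 0" and root: "is_primitive_root_of_unity p \<zeta>"
begin

lemma power_mod: "\<zeta> ^ (n mod p) = \<zeta> ^ n"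
proof -
  have "\<zeta> ^ n = \<zeta> ^ (p * (n div p) + n mod p)"
    by simp
  also have "\<dots> = \<zeta> ^ (n mod p)"
    using root unfolding power_add power_mult by (simp add: is_primitive_root_of_unity_def)
  finally show ?thesis ..
qed

lemma power_cong: "[a = b] (mod p) \<Longrightarrow> \<zeta> ^ a = \<zeta> ^ b"
  unfolding cong_def by (metis power_mod)

text \<open>A geometric series in \<open>\<zeta> ^ x\<close>; primitivity of \<open>\<zeta>\<close>
  makes the ratio differ from 1 unless \<open>p\<close> divides \<open>x\<close>.\<close>

lemma sum_powers: "(\<Sum>t<p. (\<zeta> ^ t) ^ x) = (if [x = 0] (mod p) then of_nat p else 0)"
proof -
  have swap: "(\<Sum>t<p. (\<zeta> ^ t) ^ x) = (\<Sum>t<p. (\<zeta> ^ x) ^ t)"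
    by (simp add: mult.commute flip: power_mult)
  show ?thesis
  proof (cases "[x = 0] (mod p)")
    case True
    then show ?thesis
      unfolding swap using power_cong[OF True] by simp
  next
    case False
    then have "0 < x mod p" "x mod p < p"
      using p_pos by (auto simp: cong_def)
    then have "\<zeta> ^ x \<noteq> 1"
      using root power_mod[of x] unfolding is_primitive_root_of_unity_def by metis
    moreover have "(\<zeta> ^ x) ^ p = 1"
      using root by (metis is_primitive_root_of_unity_def mult.commute power_mult power_one)
    ultimately show ?thesis
      unfolding swap using False by (simp add: geometric_sum)
  qed
qed

text \<open>Orthogonality serves as an indicator of zero sums: after exchanging the summations, each
  tuple counted by the Gauss symbol contributes \<open>p\<close> and every other tuple 0.\<close>

lemma gauss_symbol_eq_character_sum:
  assumes "\<And>M. M \<in> set Ms \<Longrightarrow> finite M"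
  shows "of_nat p * of_nat (gauss_symbol p Ms) = (\<Sum>t<p. \<Prod>M\<leftarrow>Ms. \<Sum>x\<in>M. (\<zeta> ^ t) ^ x)"
proof -
  have "(\<Sum>t<p. \<Prod>M\<leftarrow>Ms. \<Sum>x\<in>M. (\<zeta> ^ t) ^ x) =
        (\<Sum>t<p. \<Sum>xs\<in>listset Ms. (\<zeta> ^ t) ^ sum_list xs)"
    by (simp only: sum_listset_power)
  also have "\<dots> = (\<Sum>xs\<in>listset Ms. \<Sum>t<p. (\<zeta> ^ t) ^ sum_list xs)"
    by (rule sum.swap)
  also have "\<dots> = (\<Sum>xs\<in>listset Ms. if [sum_list xs = 0] (mod p) then of_nat p else 0)"
    by (simp only: sum_powers)
  also have "\<dots> = (\<Sum>xs | xs \<in> listset Ms \<and> [sum_list xs = 0] (mod p). of_nat p)"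
    using finite_listset[OF assms] by (subst sum.inter_filter[symmetric]) auto
  finally show ?thesis
    by (simp add: gauss_symbol_def mult.commute)
qed

end

section \<open>Gauss periods\<close>

locale gauss_periods = root_of_unity +
  fixes g d m :: nat
  assumes prime: "prime p" and d_pos: "d > 0" and dm: "m * d = p - 1"
    and primroot: "residue_primroot p g"
begin

text \<open>The discrete logarithm. It yields both the injective parametrization of cyclotomic
  classes and the reindexing of the nonzero frequencies.\<close>

lemma bij_betw_primroot_powers: "bij_betw (\<lambda>i. g ^ i mod p) {..<p - 1} {0<..<p}"
proof -
  have "{0<..<p} = totatives p"
    using prime by (simp add: totatives_prime)
  then show ?thesis
    using residue_primroot_is_generator[OF prime_gt_1_nat[OF prime] primroot] prime
    by (simp add: totient_prime)
qed

text \<open>Fermat's theorem for \<open>g\<close>, as \<open>m * d = p - 1\<close>. The tower is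
  read as \<open>\<zeta> ^ (g ^ n)\<close>.\<close>

lemma power_power_period: "\<zeta> ^ g ^ (n + m * d) = \<zeta> ^ g ^ n"
proof (rule power_cong)
  have "coprime g p"
    using primroot by (simp add: residue_primroot_def coprime_commute)
  then have "[g ^ (p - 1) = 1] (mod p)"
    using euler_theorem[of g p] prime by (simp add: totient_prime)
  then have "[g ^ n * g ^ (p - 1) = g ^ n * 1] (mod p)"
    by (rule cong_mult[OF cong_refl])
  then show "[g ^ (n + m * d) = g ^ n] (mod p)"
    by (simp only: power_add dm mult_1_right)
qed

lemma exponent_lt:
  assumes "j < m" "r < d"
  shows "j * d + r < p - 1"
proof -
  have "j * d + r < Suc j * d"
    using assms by simp
  also have "\<dots> \<le> m * d"
    using assms by (intro mult_le_mono1) simp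
  finally show ?thesis
    by (simp add: dm)
qed

lemma sum_cyclotomic_class:
  "(\<Sum>x\<in>cyclotomic_class p g d s. f x) = (\<Sum>j<m. f (g ^ (j * d + nat (s mod int d)) mod p))"
proof -
  have r: "nat (s mod int d) < d"
    using d_pos by (simp add: nat_less_iff)
  have "inj_on (\<lambda>j. g ^ (j * d + nat (s mod int d)) mod p) {..<m}"
  proof (rule inj_onI)
    fix i j assume ij: "i \<in> {..<m}" "j \<in> {..<m}"
      and eq: "g ^ (i * d + nat (s mod int d)) mod p = g ^ (j * d + nat (s mod int d)) mod p"
    have "i * d + nat (s mod int d) = j * d + nat (s mod int d)"
      using inj_onD[OF bij_betw_imp_inj_on[OF bij_betw_primroot_powers] eq] exponent_lt[OF _ r] ij
      by simp
    then show "i = j"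
      using d_pos by simp
  qed
  moreover have "(p - 1) div d = m"
    unfolding dm[symmetric] using d_pos by simp
  ultimately show ?thesis
    unfolding cyclotomic_class_def by (simp add: sum.reindex)
qed

lemma gauss_period_eq: "gauss_period p g d \<zeta> s = (\<Sum>j<m. \<zeta> ^ g ^ (j * d + nat (s mod int d)))"
  unfolding gauss_period_def sum_cyclotomic_class by (simp add: power_mod)

lemma gauss_period_mod: "gauss_period p g d \<zeta> (s mod int d) = gauss_period p g d \<zeta> s"
  by (simp add: gauss_period_eq)

text \<open>Allows the offset \<open>r\<close> to be any natural number instead of a residue below
  \<open>d\<close>: raising it by \<open>d\<close> only permutes the summands cyclically.\<close>

lemma gauss_period_of_nat: "gauss_period p g d \<zeta> (int r) = (\<Sum>j<m. \<zeta> ^ g ^ (j * d + r))"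
proof (induction r rule: less_induct)
  case (less r)
  show ?case
  proof (cases "r < d")
    case True
    then show ?thesis
      by (simp add: gauss_period_eq)
  next
    case False
    let ?h = "\<lambda>j. \<zeta> ^ g ^ (j * d + (r - d))"
    have "(\<Sum>j<m. \<zeta> ^ g ^ (j * d + r)) = (\<Sum>j<m. ?h (Suc j))"
      using False by (simp add: algebra_simps)
    \<comment> \<open>The shift drops the term \<open>?h 0\<close> and adds \<open>?h m\<close>;
      these agree by periodicity.\<close>
    also have "\<dots> = (\<Sum>j<m. ?h j)"
      using sum.lessThan_Suc_shift[of ?h m] power_power_period[of "r - d"]
      by (simp add: add.commute)
    also have "\<dots> = gauss_period p g d \<zeta> (int (r - d))"
      using less.IH[of "r - d"] False d_pos by simp
    also have "\<dots> = gauss_period p g d \<zeta> (int r)"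
      using False by (subst (1 2) gauss_period_mod[symmetric]) (simp add: of_nat_diff)
    finally show ?thesis ..
  qed
qed

text \<open>Multiplication by \<open>g ^ n\<close> carries the class of index \<open>s\<close> to
  that of index \<open>s + n\<close>, so changing the frequency translates the period.\<close>

lemma character_sum_cyclotomic_class:
  "(\<Sum>x\<in>cyclotomic_class p g d s. (\<zeta> ^ (g ^ n mod p)) ^ x) = gauss_period p g d \<zeta> (s + int n)"
proof -
  let ?r = "nat (s mod int d)"
  have "(\<Sum>x\<in>cyclotomic_class p g d s. (\<zeta> ^ (g ^ n mod p)) ^ x) =
        (\<Sum>j<m. \<zeta> ^ g ^ (j * d + (?r + n)))"
    unfolding sum_cyclotomic_class power_mult[symmetric]
    by (intro sum.cong refl power_cong)
      (simp add: cong_def mod_mult_eq flip: power_add, simp add: ac_simps)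
  also have "\<dots> = gauss_period p g d \<zeta> (int (?r + n))"
    by (simp only: gauss_period_of_nat)
  also have "\<dots> = gauss_period p g d \<zeta> (s + int n)"
    using d_pos by (subst (1 2) gauss_period_mod[symmetric]) (simp add: mod_simps)
  finally show ?thesis .
qed

text \<open>
  The frequency \<open>0\<close> contributes \<open>m ^ (k - 1)\<close>; the frequencies \<open>g ^ (j * d + i)\<close> with fixed \<open>i\<close>
  complete the singleton \<open>{g ^ s\<^sub>1}\<close> to a full period and send the other class sums
  to the periods of the translate by \<open>i\<close>.
\<close>
lemma sum_translates_prod_gauss_period:
  assumes S: "S \<in> k_subsets d k" and k: "k \<ge> 1"
  shows "(\<Sum>\<nu>\<in>{0..<int d}. \<Prod>s\<in>translation d \<nu> S. gauss_period p g d \<zeta> s) =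
           of_nat p * of_nat (z_symbol p g d S) - of_nat m ^ (k - 1)"
proof -
  let ?\<eta> = "gauss_period p g d \<zeta>"
  have sub: "S \<subseteq> {0..<int d}" and card: "card S = k"
    using S d_pos by (auto simp: k_subsets_def carrier_integer_mod_group)
  have fin: "finite S"
    using sub by (rule finite_subset) simp
  obtain s1 ss where ss: "sorted_list_of_set S = s1 # ss"
    using card k fin by (cases "sorted_list_of_set S") auto
  have set: "set (s1 # ss) = S" and dist: "distinct (s1 # ss)" and len: "length (s1 # ss) = k"
    using fin card by (simp_all only: ss[symmetric]) auto
  have s1: "s1 \<ge> 0"
    using set sub by auto
  \<comment> \<open>The contribution of frequency \<open>t\<close> to \<open>p * z(S)\<close>: the
    first factor belongs to the singleton, the others to the \<open>k - 1\<close> classes.\<close>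
  let ?W = "\<lambda>t. (\<zeta> ^ t) ^ (g ^ nat s1 mod p) * (\<Prod>s\<leftarrow>ss. \<Sum>x\<in>cyclotomic_class p g d s. (\<zeta> ^ t) ^ x)"
  have W0: "?W 0 = of_nat m ^ (k - 1)"
  proof -
    have "(\<Sum>x\<in>cyclotomic_class p g d s. (1 :: complex)) = of_nat m" for s
      unfolding sum_cyclotomic_class by simp
    then show ?thesis
      using len by (auto simp: map_replicate_const)
  qed
  have Wg: "?W (g ^ n mod p) = \<zeta> ^ g ^ (n + nat s1) * (\<Prod>s\<leftarrow>ss. ?\<eta> (s + int n))" for n
  proof -
    have "(\<zeta> ^ (g ^ n mod p)) ^ (g ^ nat s1 mod p) = \<zeta> ^ g ^ (n + nat s1)"
      unfolding power_mult[symmetric]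
      by (rule power_cong) (simp add: cong_def mod_mult_eq power_add)
    then show ?thesis
      by (simp only: character_sum_cyclotomic_class)
  qed
  \<comment> \<open>Translation reduces modulo \<open>d\<close>, which periods ignore; it merges no
    elements, since those of \<open>S\<close> are distinct modulo \<open>d\<close>.\<close>
  have tr: "(\<Prod>s\<in>translation d \<nu> S. ?\<eta> s) = (\<Prod>s\<in>S. ?\<eta> (s + \<nu>))" for \<nu>
  proof -
    have "inj_on (\<lambda>s. (s + \<nu>) mod int d) S"
    proof (rule inj_onI)
      fix x y assume "x \<in> S" "y \<in> S" "(x + \<nu>) mod int d = (y + \<nu>) mod int d"
      then have "[x = y] (mod int d)" "x \<in> {0..<int d}" "y \<in> {0..<int d}"
        using sub by (auto simp: cong_add_rcancel simp flip: cong_def)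
      then show "x = y"
        by (simp add: cong_def)
    qed
    then show ?thesis
      by (simp add: translation_def prod.reindex gauss_period_mod)
  qed
  have "of_nat p * of_nat (z_symbol p g d S) = (\<Sum>t<p. ?W t)"
  proof -
    let ?Ms = "{g ^ nat s1 mod p} # map (cyclotomic_class p g d) ss"
    have "of_nat p * of_nat (gauss_symbol p ?Ms) = (\<Sum>t<p. \<Prod>M\<leftarrow>?Ms. \<Sum>x\<in>M. (\<zeta> ^ t) ^ x)"
      by (rule gauss_symbol_eq_character_sum) (auto simp: cyclotomic_class_def)
    then show ?thesis
      by (simp add: z_symbol_def ss Let_def o_def)
  qed
  also have "\<dots> = ?W 0 + (\<Sum>t\<in>{0<..<p}. ?W t)"
  proof -
    have "{..<p} = insert 0 {0<..<p}"
      using p_pos by auto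
    then show ?thesis
      by simp
  qed
  also have "(\<Sum>t\<in>{0<..<p}. ?W t) = (\<Sum>n<m * d. ?W (g ^ n mod p))"
    unfolding dm using sum.reindex_bij_betw[OF bij_betw_primroot_powers, of ?W] by simp
  \<comment> \<open>Division with remainder by \<open>d\<close>: \<open>i\<close> selects the class
    of the frequency and \<open>j\<close> its element.\<close>
  also have "\<dots> = (\<Sum>j<m. \<Sum>i<d. ?W (g ^ (i + j * d) mod p))"
    unfolding sum.nat_group[symmetric] sum.atLeastLessThan_shift_0[of _ "_ * d"]
    by (simp add: atLeast0LessThan o_def add.commute)
  also have "\<dots> = (\<Sum>i<d. \<Sum>j<m. ?W (g ^ (i + j * d) mod p))"
    by (rule sum.swap)
  also have "\<dots> = (\<Sum>i<d. \<Prod>s\<in>S. ?\<eta> (s + int i))"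
  proof (rule sum.cong[OF refl])
    fix i
    \<comment> \<open>The periods do not depend on \<open>j\<close>, so they factor out and only the
      singleton term is summed over \<open>j\<close>.\<close>
    have shift: "?\<eta> (s + int (i + j * d)) = ?\<eta> (s + int i)" for s j
      by (subst (1 2) gauss_period_mod[symmetric]) (simp flip: add.assoc)
    have "(\<Sum>j<m. ?W (g ^ (i + j * d) mod p)) =
          (\<Sum>j<m. \<zeta> ^ g ^ (j * d + (nat s1 + i))) * (\<Prod>s\<leftarrow>ss. ?\<eta> (s + int i))"
      unfolding Wg shift sum_distrib_right by (simp add: ac_simps)
    also have "\<dots> = ?\<eta> (int (nat s1 + i)) * (\<Prod>s\<leftarrow>ss. ?\<eta> (s + int i))"
      by (simp only: gauss_period_of_nat)
    also have "\<dots> = (\<Prod>s\<leftarrow>s1 # ss. ?\<eta> (s + int i))"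
      using s1 by simp
    also have "\<dots> = (\<Prod>s\<in>S. ?\<eta> (s + int i))"
      using prod.distinct_set_conv_list[OF dist] set by metis
    finally show "(\<Sum>j<m. ?W (g ^ (i + j * d) mod p)) = (\<Prod>s\<in>S. ?\<eta> (s + int i))" .
  qed
  also have "\<dots> = (\<Sum>\<nu>\<in>{0..<int d}. \<Prod>s\<in>translation d \<nu> S. ?\<eta> s)"
    unfolding tr by (rule sum.reindex_bij_witness[of _ nat int]) auto
  finally show ?thesis
    by (simp only: W0 add_diff_cancel_left')
qed

end

section \<open>Assembling the coefficient from the contributions of the stabilizer orders\<close>

theorem theorem1:
  fixes p d m k g :: nat and \<zeta> :: complex and T :: "nat \<Rightarrow> int set set"
  assumes "prime p" and "odd p"
    and "d \<ge> 2" and "d dvd p - 1" and "m = (p - 1) div d"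
    and "1 \<le> k" and "k \<le> d"
    and "residue_primroot p g"
    and "is_primitive_root_of_unity p \<zeta>"
    and "\<And>e. e dvd gcd d k \<Longrightarrow> is_transversal d k e (T e)"
  shows "viete_coeff p g d \<zeta> k =
    (\<Sum>e | e dvd gcd d k. 1 / of_nat e *
       (of_nat p * (\<Sum>S\<in>T e. of_nat (z_symbol p g d S))
          - of_nat (card (T e)) * of_nat m ^ (k - 1)))"
proof -
  interpret gauss_periods p \<zeta> g d m
    using assms by unfold_locales (auto simp: prime_gt_0_nat)
  let ?P = "\<lambda>S. \<Prod>s\<in>S. gauss_period p g d \<zeta> s"
  let ?D = "{e. e dvd gcd d k}"
  let ?stab = "\<lambda>S. card (stabilizer (integer_mod_group d) (translation d) S)"
  have d: "d > 0"
    by (rule d_pos)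
  have finM: "finite (k_subsets d k)"
    using d by (auto simp: k_subsets_def carrier_integer_mod_group)
  have finD: "finite ?D"
    using d by (intro finite_divisors_nat) simp
  have "viete_coeff p g d \<zeta> k = (\<Sum>S\<in>k_subsets d k. ?P S)"
    using d assms by (intro viete_coeff_eq_sum_k_subsets)
  also have "\<dots> = (\<Sum>e\<in>?D. \<Sum>S | S \<in> k_subsets d k \<and> ?stab S = e. ?P S)"
    \<comment> \<open>Grouping by stabilizer order loses no subset because each order divides
      \<open>gcd d k\<close>.\<close>
    using card_stabilizer_dvd_gcd[OF d] finM finD by (subst sum.group) auto
  also have "\<dots> = (\<Sum>e\<in>?D. 1 / of_nat e *
       (of_nat p * (\<Sum>S\<in>T e. of_nat (z_symbol p g d S)) - of_nat (card (T e)) * of_nat m ^ (k - 1)))"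
  proof (rule sum.cong[OF refl])
    fix e assume "e \<in> ?D"
    then have dvd: "e dvd gcd d k"
      by simp
    \<comment> \<open>Zero divides only zero, while \<open>gcd d k\<close> is positive.\<close>
    then have e: "e > 0"
      using d by (auto intro: Nat.gr0I)
    have TM: "S \<in> k_subsets d k" if "S \<in> T e" for S
      using assms(10)[OF dvd] that by (auto simp: is_transversal_def k_subsets_stab_def)
    have "(\<Sum>S | S \<in> k_subsets d k \<and> ?stab S = e. ?P S) =
          (\<Sum>S\<in>T e. 1 / of_nat e * (\<Sum>\<nu>\<in>{0..<int d}. ?P (translation d \<nu> S)))"
      using sum_transversal[OF d e assms(10)[OF dvd]] by (simp add: k_subsets_stab_def)
    also have "\<dots> = (\<Sum>S\<in>T e. 1 / of_nat e *
                     (of_nat p * of_nat (z_symbol p g d S) - of_nat m ^ (k - 1)))"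
      using sum_translates_prod_gauss_period[OF TM] assms by (intro sum.cong) auto
    finally show "(\<Sum>S | S \<in> k_subsets d k \<and> ?stab S = e. ?P S) =
        1 / of_nat e * (of_nat p * (\<Sum>S\<in>T e. of_nat (z_symbol p g d S))
          - of_nat (card (T e)) * of_nat m ^ (k - 1))"
      by (simp add: sum_subtractf flip: sum_distrib_left sum_divide_distrib)
  qed
  finally show ?thesis .
qed

end
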